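(* Let $\rho\in\mathbb R$, and let $k$ be a diagonal Dirichlet series kernel on $\mathbb H_\rho$ with reproducing kernel Hilbert space $\mathcal H(k)$. Suppose there exists a real number $t>\rho$ such that $k_t^2\in\mathcal H(k)$. Then $k_u^2\in\mathcal H(k)$ for every $u\in\mathbb H_t$. Moreover, a bounded linear functional $\Lambda:\mathcal H(k)\to\mathbb C$ satisfying $\Lambda(1)=1$ is multiplicative if and only if $\Lambda(k_u^2)=\Lambda(k_u)^2$ for every $u\in\mathbb H_t$.
   Context: For $\rho\in\mathbb R$, $\mathbb H_\rho=\{\lambda\in\mathbb C:\operatorname{Re}(\lambda)>\rho\}$. A diagonal Dirichlet series kernel on $\mathbb H_\rho$ is a kernel of the form $k(\lambda,u)=\sum_{n=1}^\infty c_n n^{-\lambda-\overline u}$, $\lambda,u\in\mathbb H_\rho$, where $c_n>0$ for every $n$ and the series converges on $\mathbb H_\rho\times\mathbb H_\rho$. Its reproducing kernel Hilbert space is $\mathcal H(k)=\{\sum_{n\ge1}a_n n^{-\lambda}:\sum_{n\ge1}|a_n|^2/c_n<\infty\}$, a space of functions on $\mathbb H_\rho$ with squared norm $\sum_n|a_n|^2/c_n$. For $u\in\mathbb H_\rho$, $k_u(\lambda)=k(\lambda,u)$ and $k_u^2(\lambda)=k(\lambda,u)^2$. A linear functional $\Lambda$ on $\mathcal H(k)$ is multiplicative if $\Lambda(fg)=\Lambda(f)\Lambda(g)$ whenever $f,g\in\mathcal H(k)$ are such that the pointwise product $fg$ is also in $\mathcal H(k)$. *)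

theory Defs
  imports "HOL-Analysis.Analysis"
begin

definition half_plane :: "real \<Rightarrow> complex set" where
  "half_plane \<rho> = {z. Re z > \<rho>}"

text \<open>
  Coefficient sequences are indexed by the positive integers: the value at \<open>0\<close> is never used,
  and series are written with summation index \<open>Suc n\<close>.
\<close>

definition diagonal_dirichlet_kernel :: "real \<Rightarrow> (nat \<Rightarrow> real) \<Rightarrow> bool" where
  "diagonal_dirichlet_kernel \<rho> c \<longleftrightarrow>
     (\<forall>n\<ge>1. c n > 0) \<and>
     (\<forall>z\<in>half_plane \<rho>. \<forall>u\<in>half_plane \<rho>.
        summable (\<lambda>n. complex_of_real (c (Suc n)) * of_nat (Suc n) powr (- z - cnj u)))"

text \<open>
  Functions on \<open>half_plane \<rho>\<close> are represented by total functions that vanish outside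
  \<open>half_plane \<rho>\<close>. This makes the representative unique, and sums, scalar multiples and
  products of representatives are taken pointwise.
\<close>

definition dirichlet_kernel :: "real \<Rightarrow> (nat \<Rightarrow> real) \<Rightarrow> complex \<Rightarrow> complex \<Rightarrow> complex" where
  "dirichlet_kernel \<rho> c z u =
     (if z \<in> half_plane \<rho> \<and> u \<in> half_plane \<rho>
      then (\<Sum>n. complex_of_real (c (Suc n)) * of_nat (Suc n) powr (- z - cnj u)) else 0)"

definition kernel_fun :: "real \<Rightarrow> (nat \<Rightarrow> real) \<Rightarrow> complex \<Rightarrow> (complex \<Rightarrow> complex)" where
  "kernel_fun \<rho> c u = (\<lambda>z. dirichlet_kernel \<rho> c z u)"

definition one_fun :: "real \<Rightarrow> (complex \<Rightarrow> complex)" where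
  "one_fun \<rho> = (\<lambda>z. if z \<in> half_plane \<rho> then 1 else 0)"

definition has_dirichlet_series :: "real \<Rightarrow> (complex \<Rightarrow> complex) \<Rightarrow> (nat \<Rightarrow> complex) \<Rightarrow> bool" where
  "has_dirichlet_series \<rho> f a \<longleftrightarrow>
     (\<forall>z\<in>half_plane \<rho>. (\<lambda>n. a (Suc n) * of_nat (Suc n) powr (- z)) sums f z) \<and>
     (\<forall>z. z \<notin> half_plane \<rho> \<longrightarrow> f z = 0)"

definition dirichlet_rkhs :: "real \<Rightarrow> (nat \<Rightarrow> real) \<Rightarrow> (complex \<Rightarrow> complex) set" where
  "dirichlet_rkhs \<rho> c =
     {f. \<exists>a. has_dirichlet_series \<rho> f a \<and> summable (\<lambda>n. (cmod (a (Suc n)))\<^sup>2 / c (Suc n))}"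

text \<open>
  The coefficients of \<open>f\<close> at positive indices are unique, so the choice below does not affect the
  value: see \<open>dirichlet_norm_eq\<close>.
\<close>

definition dirichlet_norm :: "real \<Rightarrow> (nat \<Rightarrow> real) \<Rightarrow> (complex \<Rightarrow> complex) \<Rightarrow> real" where
  "dirichlet_norm \<rho> c f =
     (let a = (SOME a. has_dirichlet_series \<rho> f a)
      in sqrt (\<Sum>n. (cmod (a (Suc n)))\<^sup>2 / c (Suc n)))"

text \<open>
  A functional on the space is a function on the ambient function type; its values outside
  \<open>dirichlet_rkhs \<rho> c\<close> are irrelevant.
\<close>

definition bounded_linear_functional ::
    "real \<Rightarrow> (nat \<Rightarrow> real) \<Rightarrow> ((complex \<Rightarrow> complex) \<Rightarrow> complex) \<Rightarrow> bool" where
  "bounded_linear_functional \<rho> c \<Lambda> \<longleftrightarrow>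
     (\<forall>f\<in>dirichlet_rkhs \<rho> c. \<forall>g\<in>dirichlet_rkhs \<rho> c. \<Lambda> (\<lambda>z. f z + g z) = \<Lambda> f + \<Lambda> g) \<and>
     (\<forall>f\<in>dirichlet_rkhs \<rho> c. \<forall>b. \<Lambda> (\<lambda>z. b * f z) = b * \<Lambda> f) \<and>
     (\<exists>M. \<forall>f\<in>dirichlet_rkhs \<rho> c. cmod (\<Lambda> f) \<le> M * dirichlet_norm \<rho> c f)"

definition multiplicative_functional ::
    "real \<Rightarrow> (nat \<Rightarrow> real) \<Rightarrow> ((complex \<Rightarrow> complex) \<Rightarrow> complex) \<Rightarrow> bool" where
  "multiplicative_functional \<rho> c \<Lambda> \<longleftrightarrow>
     (\<forall>f\<in>dirichlet_rkhs \<rho> c. \<forall>g\<in>dirichlet_rkhs \<rho> c.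
        (\<lambda>z. f z * g z) \<in> dirichlet_rkhs \<rho> c \<longrightarrow> \<Lambda> (\<lambda>z. f z * g z) = \<Lambda> f * \<Lambda> g)"

lemma dirichlet_series_zero:
  fixes d :: "nat \<Rightarrow> complex"
  assumes d: "\<And>z. z \<in> half_plane \<rho> \<Longrightarrow> (\<lambda>n. d (Suc n) * of_nat (Suc n) powr (- z)) sums 0"
  shows "d (Suc N) = 0"
proof (induction N rule: less_induct)
  case (less N)
  define s0 where "s0 = complex_of_real (\<rho> + 1)"
  define b where "b = (\<lambda>m. d (Suc m) * of_nat (Suc m) powr (- s0))"
  have "s0 \<in> half_plane \<rho>" by (simp add: s0_def half_plane_def)
  from d[OF this] have "summable b" unfolding b_def by (rule sums_summable)
  then have "Bseq b"
    using convergent_imp_Bseq convergent_def summable_LIMSEQ_zero by blast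
  then obtain B where B: "\<And>m. cmod (b m) \<le> B" by (auto simp: Bseq_def)
  define a where "a = (\<lambda>m j. b m * (of_nat (Suc N) / of_nat (Suc m)) ^ j / of_nat (Suc m) ^ 2)"
  have sums: "(\<lambda>m. a m j) sums 0" for j
  proof -
    have "s0 + of_nat (j + 2) \<in> half_plane \<rho>" by (simp add: s0_def half_plane_def)
    from sums_mult[OF d[OF this], of "of_nat (Suc N) ^ j"]
    have "(\<lambda>m. of_nat (Suc N) ^ j *
            (d (Suc m) * of_nat (Suc m) powr (- (s0 + of_nat (j + 2))))) sums 0" by simp
    moreover have "of_nat (Suc N) ^ j *
            (d (Suc m) * of_nat (Suc m) powr (- (s0 + of_nat (j + 2)))) = a m j" for m
    proof -
      have nz: "of_nat (Suc m) \<noteq> (0 :: complex)" by (simp del: of_nat_Suc)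
      have "of_nat (Suc m) powr (- (s0 + of_nat (j + 2))) =
            of_nat (Suc m) powr (- s0) / of_nat (Suc m) powr (of_nat (j + 2) :: complex)"
        by (simp only: powr_diff[symmetric] minus_add_distrib diff_conv_add_uminus)
      also have "of_nat (Suc m) powr (of_nat (j + 2) :: complex) = of_nat (Suc m) ^ (j + 2)"
        using nz by (intro powr_nat') simp
      finally have eq: "of_nat (Suc m) powr (- (s0 + of_nat (j + 2))) =
            of_nat (Suc m) powr (- s0) / of_nat (Suc m) ^ (j + 2)" .
      show ?thesis
        unfolding a_def b_def eq
        by (simp only: power_add power_divide times_divide_eq_right times_divide_eq_left
            divide_divide_eq_left mult_ac)
    qed
    ultimately show ?thesis by simp
  qed
  define l where "l = (\<lambda>m. if m = N then b N / of_nat (Suc N) ^ 2 else 0)"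
  have zero: "a m j = 0" if "m < N" for m j
    using less[OF that] by (simp add: a_def b_def)
  have lim: "(\<lambda>j. a m j) \<longlonglongrightarrow> l m" for m
  proof (cases m N rule: linorder_cases)
    case less
    then show ?thesis by (simp add: zero l_def)
  next
    case equal
    then show ?thesis by (simp add: a_def l_def del: of_nat_Suc)
  next
    case greater
    then have "cmod (of_nat (Suc N) / of_nat (Suc m)) < 1"
      unfolding norm_divide norm_of_nat by (simp add: divide_less_eq)
    then have "(\<lambda>j. (of_nat (Suc N) / of_nat (Suc m) :: complex) ^ j) \<longlonglongrightarrow> 0"
      by (rule LIMSEQ_power_zero)
    then have "(\<lambda>j. b m * (of_nat (Suc N) / of_nat (Suc m)) ^ j / of_nat (Suc m) ^ 2)
                 \<longlonglongrightarrow> b m * 0 / of_nat (Suc m) ^ 2"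
      by (intro tendsto_divide tendsto_mult tendsto_const) (simp_all del: of_nat_Suc)
    with greater show ?thesis by (simp add: a_def l_def)
  qed
  have B0: "B \<ge> 0" using B[of 0] norm_ge_zero order_trans by blast
  have bound: "cmod (a m j) \<le> B * inverse (of_nat (Suc m) ^ 2)" for m j
  proof (cases "m < N")
    case True
    then show ?thesis using B0 by (simp add: zero)
  next
    case False
    then have "(real (Suc N) / real (Suc m)) ^ j \<le> 1"
      by (intro power_le_one) (auto simp del: of_nat_Suc)
    then have "cmod (b m) * (real (Suc N) / real (Suc m)) ^ j \<le> B * 1"
      by (intro mult_mono B B0) auto
    then show ?thesis
      unfolding a_def norm_divide norm_mult norm_power norm_of_nat
      by (simp add: divide_inverse mult_right_mono)
  qed
  have "summable (\<lambda>m. B * inverse (real (Suc m) ^ 2))"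
    using inverse_power_summable[of 2, where ?'a = real]
    by (intro summable_mult) (subst summable_Suc_iff, simp)
  moreover have "\<forall>\<^sub>F (m, j) in at_top \<times>\<^sub>F sequentially. cmod (a m j) \<le> B * inverse (real (Suc m) ^ 2)"
    using bound by (intro always_eventually) auto
  ultimately have "(\<lambda>j. suminf (\<lambda>m. a m j)) \<longlonglongrightarrow> suminf l"
    using tannerys_theorem[of a l sequentially "\<lambda>m. B * inverse (real (Suc m) ^ 2)"]
      lim sequentially_bot by blast
  moreover have "suminf (\<lambda>m. a m j) = 0" for j using sums[of j] by (simp add: sums_iff)
  moreover have "suminf l = b N / of_nat (Suc N) ^ 2"
    using sums_single[of N "\<lambda>_. b N / of_nat (Suc N) ^ 2"] by (simp add: l_def sums_iff)
  ultimately have "b N / of_nat (Suc N) ^ 2 = 0"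
    by (simp add: LIMSEQ_const_iff del: of_nat_Suc)
  then have "b N = 0" by (simp del: of_nat_Suc)
  then show ?case by (simp add: b_def del: of_nat_Suc)
qed

lemma has_dirichlet_series_unique:
  assumes "has_dirichlet_series \<rho> f a" "has_dirichlet_series \<rho> f a'"
  shows "a (Suc n) = a' (Suc n)"
proof -
  have "(\<lambda>n. (a (Suc n) - a' (Suc n)) * of_nat (Suc n) powr (- z)) sums 0"
    if "z \<in> half_plane \<rho>" for z
  proof -
    have "(\<lambda>n. a (Suc n) * of_nat (Suc n) powr (- z) - a' (Suc n) * of_nat (Suc n) powr (- z))
            sums (f z - f z)"
      using assms that unfolding has_dirichlet_series_def by (intro sums_diff) auto
    then show ?thesis by (simp add: left_diff_distrib)
  qed
  from dirichlet_series_zero[of \<rho> "\<lambda>n. a n - a' n", OF this] show ?thesis by simp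
qed

lemma dirichlet_norm_eq:
  assumes "has_dirichlet_series \<rho> f a"
  shows "dirichlet_norm \<rho> c f = sqrt (\<Sum>n. (cmod (a (Suc n)))\<^sup>2 / c (Suc n))"
proof -
  have "has_dirichlet_series \<rho> f (SOME a. has_dirichlet_series \<rho> f a)"
    using assms by (rule someI[of "has_dirichlet_series \<rho> f"])
  from has_dirichlet_series_unique[OF this assms] show ?thesis
    by (simp add: dirichlet_norm_def Let_def)
qed

end

theory Submission
  imports Defs
begin

text \<open>
  A bounded functional acts on a Dirichlet series by \<open>\<Lambda> f = (\<Sum>n. a n * L n)\<close> with
  \<open>L n = \<Lambda> (n\<^sup>-\<^sup>z)\<close>. Both sides of \<open>\<Lambda> (k\<^sub>u\<^sup>2) = (\<Lambda> k\<^sub>u)\<^sup>2\<close> are then Dirichlet series in the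
  conjugate of \<open>u\<close>, and comparing coefficients gives \<open>(c * c) n * L n = (cL * cL) n\<close> for Dirichlet
  convolution. Since \<open>c > 0\<close> and \<open>L 1 = 1\<close>, this forces \<open>L\<close> to be completely multiplicative, which
  makes \<open>\<Lambda>\<close> multiplicative on products of series.
\<close>

section \<open>Dirichlet convolution and products of absolutely convergent series\<close>

text \<open>At \<open>n = 0\<close> every natural number is a divisor, and a sum over an infinite
  set is \<open>0\<close> by convention; identities such as \<open>dirichlet_conv_powr\<close>
  therefore hold for all \<open>n\<close> without a side condition.\<close>

definition dirichlet_conv :: "(nat \<Rightarrow> 'a) \<Rightarrow> (nat \<Rightarrow> 'a) \<Rightarrow> nat \<Rightarrow> 'a::comm_ring_1" where
  "dirichlet_conv a b n = (\<Sum>d | d dvd n. a d * b (n div d))"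

lemma of_nat_powr_mult:
  "of_nat (m * n) powr z = of_nat m powr z * (of_nat n powr z :: complex)"
  by (simp add: powr_times_real)

lemma norm_of_nat_powr:
  "cmod (of_nat (Suc n) powr z) = real (Suc n) powr Re z"
  by (subst norm_powr_real_powr) (auto simp del: of_nat_Suc)

text \<open>Since \<open>n powr z\<close> is completely multiplicative in \<open>n\<close>, twisting
  both factors by it twists their convolution.\<close>

lemma dirichlet_conv_powr:
  "dirichlet_conv (\<lambda>n. a n * of_nat n powr z) (\<lambda>n. b n * of_nat n powr z) n =
     dirichlet_conv a b n * (of_nat n powr z :: complex)"
  unfolding dirichlet_conv_def sum_distrib_right
proof (rule sum.cong[OF refl], safe)
  fix d assume "d dvd n"
  then have "of_nat n powr z = of_nat d powr z * (of_nat (n div d) powr z :: complex)"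
    using of_nat_powr_mult[of d "n div d" z] by simp
  then show "a d * of_nat d powr z * (b (n div d) * of_nat (n div d) powr z) =
      a d * b (n div d) * of_nat n powr z"
    by simp
qed

text \<open>Absolute convergence makes the family of all products of two terms summable over pairs
  of indices, so it may be regrouped by the product of the indices; each group is a finite divisor
  sum.\<close>

lemma dirichlet_conv_sums:
  fixes x y :: "nat \<Rightarrow> complex"
  assumes x: "summable (\<lambda>n. cmod (x (Suc n)))" and y: "summable (\<lambda>n. cmod (y (Suc n)))"
  shows "(\<lambda>n. dirichlet_conv x y (Suc n)) sums ((\<Sum>n. x (Suc n)) * (\<Sum>n. y (Suc n)))"
proof -
  define S where "S = (\<Sum>n. x (Suc n)) * (\<Sum>n. y (Suc n))"
  have hx: "((\<lambda>n. x (Suc n)) has_sum (\<Sum>n. x (Suc n))) UNIV"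
    by (rule norm_summable_imp_has_sum[OF x summable_sums[OF summable_norm_cancel[OF x]]])
  have hy: "((\<lambda>n. y (Suc n)) has_sum (\<Sum>n. y (Suc n))) UNIV"
    by (rule norm_summable_imp_has_sum[OF y summable_sums[OF summable_norm_cancel[OF y]]])
  have ax: "(\<lambda>n. cmod (x (Suc n))) summable_on UNIV"
    using norm_summable_imp_summable_on[of "\<lambda>n. cmod (x (Suc n))"] x by simp
  have ay: "(\<lambda>n. cmod (y (Suc n))) summable_on UNIV"
    using norm_summable_imp_summable_on[of "\<lambda>n. cmod (y (Suc n))"] y by simp
  have "(\<lambda>p. cmod (x (Suc (fst p)) * y (Suc (snd p)))) summable_on UNIV \<times> UNIV"
    by (rule iffD2[OF Infinite_Sum.abs_summable_on_Sigma_iff[where f = "\<lambda>p. x (Suc (fst p)) * y (Suc (snd p))"]])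
      (use ax ay in \<open>simp add: summable_on_cmult_right infsum_cmult_right'
        summable_on_cmult_left norm_mult infsum_nonneg\<close>)
  then have sm: "(\<lambda>p. x (Suc (fst p)) * y (Suc (snd p))) summable_on UNIV \<times> UNIV"
    by (rule Infinite_Sum.abs_summable_summable)
  have Suc_mult: "Suc (Suc i * Suc j - 1) = Suc i * Suc j" for i j by simp
  have "((\<lambda>p. x (Suc (fst p)) * y (Suc (snd p))) has_sum S) (UNIV \<times> UNIV)"
    unfolding S_def
    by (rule has_sum_SigmaI[where g = "\<lambda>i. x (Suc i) * (\<Sum>n. y (Suc n))"])
      (use hx hy sm in \<open>simp_all add: has_sum_cmult_right has_sum_cmult_left\<close>)
  \<comment> \<open>Summation indices are shifted by one, divisors are not: a pair
    \<open>(p, q)\<close> goes to \<open>(n, d)\<close> with \<open>Suc n = Suc p * Suc q\<close>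
    and \<open>d = Suc p\<close>.\<close>
  also have "?this \<longleftrightarrow> ((\<lambda>p. x (snd p) * y (Suc (fst p) div snd p)) has_sum S)
      (Sigma UNIV (\<lambda>n. {d. d dvd Suc n}))"
  proof (rule has_sum_reindex_bij_witness[where
          i = "\<lambda>p. (snd p - 1, Suc (fst p) div snd p - 1)" and
          j = "\<lambda>p. (Suc (fst p) * Suc (snd p) - 1, Suc (fst p))"])
    fix q :: "nat \<times> nat" assume "q \<in> Sigma UNIV (\<lambda>n. {d. d dvd Suc n})"
    then obtain n d e where q: "q = (n, d)" "Suc n = d * e" by (cases q) (auto simp: dvd_def)
    then obtain d' e' where de: "d = Suc d'" "e = Suc e'"
      by (metis mult_0 mult_0_right nat.distinct(1) not0_implies_Suc)
    have "Suc n div d = Suc e'"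
      unfolding q(2) de by (rule nonzero_mult_div_cancel_left) simp
    then show "(\<lambda>p. (Suc (fst p) * Suc (snd p) - 1, Suc (fst p)))
        (snd q - 1, Suc (fst q) div snd q - 1) = q"
      using q de by simp
  qed (simp_all add: Suc_mult del: mult_Suc mult_Suc_right One_nat_def)
  finally have *: "((\<lambda>p. x (snd p) * y (Suc (fst p) div snd p)) has_sum S)
      (Sigma UNIV (\<lambda>n. {d. d dvd Suc n}))" .
  have "((\<lambda>n. dirichlet_conv x y (Suc n)) has_sum S) UNIV"
  proof (rule has_sum_SigmaD[OF *])
    fix n
    show "((\<lambda>d. x (snd (n, d)) * y (Suc (fst (n, d)) div snd (n, d))) has_sum
        dirichlet_conv x y (Suc n)) {d. d dvd Suc n}"
      unfolding dirichlet_conv_def fst_conv snd_conv by (rule has_sum_finite) simp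
  qed
  then show ?thesis unfolding S_def by (rule has_sum_imp_sums)
qed


section \<open>Coefficient sequences, membership in the space, and monomials\<close>

definition square_summable_coeffs :: "(nat \<Rightarrow> real) \<Rightarrow> (nat \<Rightarrow> complex) \<Rightarrow> bool" where
  "square_summable_coeffs c a \<longleftrightarrow> summable (\<lambda>n. (cmod (a (Suc n)))\<^sup>2 / c (Suc n))"

definition dirichlet_fun :: "real \<Rightarrow> (nat \<Rightarrow> complex) \<Rightarrow> complex \<Rightarrow> complex" where
  "dirichlet_fun \<rho> a z =
     (if z \<in> half_plane \<rho> then (\<Sum>n. a (Suc n) * of_nat (Suc n) powr (- z)) else 0)"

definition dirichlet_monomial :: "real \<Rightarrow> nat \<Rightarrow> complex \<Rightarrow> complex" where
  "dirichlet_monomial \<rho> m z = (if z \<in> half_plane \<rho> then of_nat m powr (- z) else 0)"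

lemma mem_dirichlet_rkhs:
  "f \<in> dirichlet_rkhs \<rho> c \<longleftrightarrow>
     (\<exists>a. has_dirichlet_series \<rho> f a \<and> square_summable_coeffs c a)"
  by (simp add: dirichlet_rkhs_def square_summable_coeffs_def)

lemma square_summable_coeffs_finite:
  "finite {n. a (Suc n) \<noteq> 0} \<Longrightarrow> square_summable_coeffs c a"
  unfolding square_summable_coeffs_def by (rule summable_finite) auto

text \<open>Coefficients are unique, so the sequence hidden in the membership is the given one. This
  serves for squares and products, whose series is computed while membership comes from
  elsewhere.\<close>

lemma has_dirichlet_series_imp_square_summable:
  assumes "f \<in> dirichlet_rkhs \<rho> c" "has_dirichlet_series \<rho> f a"
  shows "square_summable_coeffs c a"
proof -
  from assms(1) obtain b where "has_dirichlet_series \<rho> f b" "square_summable_coeffs c b"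
    unfolding mem_dirichlet_rkhs by blast
  with has_dirichlet_series_unique[OF assms(2), of b] show ?thesis
    by (simp add: square_summable_coeffs_def)
qed

lemma one_fun_eq_dirichlet_monomial: "one_fun \<rho> = dirichlet_monomial \<rho> 1"
  by (auto simp: one_fun_def dirichlet_monomial_def)

lemma has_dirichlet_series_monomial:
  "has_dirichlet_series \<rho> (dirichlet_monomial \<rho> (Suc m)) (\<lambda>n. if n = Suc m then 1 else 0)"
  unfolding has_dirichlet_series_def
proof (intro conjI ballI allI impI)
  fix z assume "z \<in> half_plane \<rho>"
  then show "(\<lambda>n. (if Suc n = Suc m then 1 else 0) * of_nat (Suc n) powr (- z)) sums
      dirichlet_monomial \<rho> (Suc m) z"
    using sums_single[of m "\<lambda>n. of_nat (Suc n) powr (- z)"]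
    by (simp add: dirichlet_monomial_def if_distrib[of "\<lambda>x. x * _"] cong: if_cong)
qed (simp add: dirichlet_monomial_def)

lemma dirichlet_monomial_mem: "dirichlet_monomial \<rho> (Suc m) \<in> dirichlet_rkhs \<rho> c"
  unfolding mem_dirichlet_rkhs
  by (rule exI conjI has_dirichlet_series_monomial square_summable_coeffs_finite)+ simp

section \<open>Absolute convergence and products of series in the space\<close>

context
  fixes \<rho> :: real and c :: "nat \<Rightarrow> real"
  assumes kernel: "diagonal_dirichlet_kernel \<rho> c"
begin

lemma kernel_coeff_pos: "c (Suc n) > 0"
  using kernel by (simp add: diagonal_dirichlet_kernel_def)

text \<open>This is the convergence of the kernel series at the diagonal point
  \<open>(x, x)\<close>, whose terms are real.\<close>

lemma summable_kernel_weights: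
  assumes "x > \<rho>"
  shows "summable (\<lambda>n. c (Suc n) * (real (Suc n) powr (- x))\<^sup>2)"
proof -
  have "complex_of_real x \<in> half_plane \<rho>" using assms by (simp add: half_plane_def)
  then have "summable (\<lambda>n. of_real (c (Suc n)) *
      of_nat (Suc n) powr (- complex_of_real x - cnj (complex_of_real x)))"
    using kernel unfolding diagonal_dirichlet_kernel_def by blast
  also have "(\<lambda>n. of_real (c (Suc n)) *
      of_nat (Suc n) powr (- complex_of_real x - cnj (complex_of_real x))) =
      (\<lambda>n. complex_of_real (c (Suc n) * (real (Suc n) powr (- x))\<^sup>2))"
  proof
    fix n
    have "of_nat (Suc n) powr (- complex_of_real x - cnj (complex_of_real x)) =
        complex_of_real (real (Suc n)) powr complex_of_real (- x - x)" by simp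
    also have "\<dots> = complex_of_real (real (Suc n) powr (- x - x))"
      by (rule powr_of_real) simp
    also have "real (Suc n) powr (- x - x) = (real (Suc n) powr (- x))\<^sup>2"
      by (simp only: diff_conv_add_uminus powr_add power2_eq_square)
    finally show "of_real (c (Suc n)) *
      of_nat (Suc n) powr (- complex_of_real x - cnj (complex_of_real x)) =
      complex_of_real (c (Suc n) * (real (Suc n) powr (- x))\<^sup>2)" by simp
  qed
  finally show ?thesis using summable_of_real_iff by blast
qed

text \<open>A termwise form of Cauchy-Schwarz: weighting by \<open>sqrt (c (Suc n))\<close> splits
  each term into a product \<open>X * Y\<close>, bounded by \<open>X\<^sup>2 + Y\<^sup>2\<close>.
  The first squares form the norm series, the second ones the kernel series at \<open>Re z\<close>
  on the diagonal.\<close>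

lemma square_summable_imp_abs_convergent:
  assumes a: "square_summable_coeffs c a" and z: "z \<in> half_plane \<rho>"
  shows "summable (\<lambda>n. cmod (a (Suc n) * of_nat (Suc n) powr (- z)))"
proof (rule summable_comparison_test')
  let ?p = "\<lambda>n. real (Suc n) powr (- Re z)"
  show "summable (\<lambda>n. (cmod (a (Suc n)))\<^sup>2 / c (Suc n) + c (Suc n) * (?p n)\<^sup>2)"
    using a z summable_kernel_weights[of "Re z"]
    by (intro summable_add) (auto simp: square_summable_coeffs_def half_plane_def)
  fix n :: nat
  let ?s = "sqrt (c (Suc n))"
  have s: "?s > 0" "?s\<^sup>2 = c (Suc n)" using kernel_coeff_pos[of n] by auto
  have "cmod (a (Suc n) * of_nat (Suc n) powr (- z)) = cmod (a (Suc n)) * ?p n"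
    by (simp only: norm_mult norm_of_nat_powr uminus_complex.sel)
  also have "\<dots> = (cmod (a (Suc n)) / ?s) * (?s * ?p n)" using s by simp
  also have "\<dots> \<le> (cmod (a (Suc n)) / ?s)\<^sup>2 + (?s * ?p n)\<^sup>2"
  proof -
    define X Y where "X = cmod (a (Suc n)) / ?s" and "Y = ?s * ?p n"
    have "X \<ge> 0" "Y \<ge> 0" using s by (auto simp: X_def Y_def)
    then have "X * Y \<ge> 0" "2 * X * Y \<le> X\<^sup>2 + Y\<^sup>2" by (auto simp: sum_squares_bound)
    then show ?thesis unfolding X_def Y_def by linarith
  qed
  also have "\<dots> = (cmod (a (Suc n)))\<^sup>2 / c (Suc n) + c (Suc n) * (?p n)\<^sup>2"
    by (simp only: power_divide power_mult_distrib s(2))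
  finally show "norm (cmod (a (Suc n) * of_nat (Suc n) powr (- z))) \<le>
      (cmod (a (Suc n)))\<^sup>2 / c (Suc n) + c (Suc n) * (?p n)\<^sup>2" by (simp del: of_nat_Suc)
qed

text \<open>Realizes any square summable sequence by an actual function, so that a functional can be
  applied to sequences built by hand.\<close>

lemma has_dirichlet_series_dirichlet_fun:
  assumes "square_summable_coeffs c a"
  shows "has_dirichlet_series \<rho> (dirichlet_fun \<rho> a) a"
  unfolding has_dirichlet_series_def dirichlet_fun_def
  using summable_sums[OF summable_norm_cancel[OF square_summable_imp_abs_convergent[OF assms]]]
  by simp

text \<open>Both series converge absolutely at each point of the half plane, so they multiply by
  convolution. Nothing is claimed about the product lying in the space.\<close>

lemma has_dirichlet_series_mult:
  assumes "has_dirichlet_series \<rho> f a" "square_summable_coeffs c a"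
    and "has_dirichlet_series \<rho> g b" "square_summable_coeffs c b"
  shows "has_dirichlet_series \<rho> (\<lambda>z. f z * g z) (dirichlet_conv a b)"
  unfolding has_dirichlet_series_def
proof (intro conjI ballI allI impI)
  fix z assume z: "z \<in> half_plane \<rho>"
  have "f z = (\<Sum>n. a (Suc n) * of_nat (Suc n) powr (- z))"
    "g z = (\<Sum>n. b (Suc n) * of_nat (Suc n) powr (- z))"
    using assms z by (auto simp: has_dirichlet_series_def sums_iff)
  with dirichlet_conv_sums[OF square_summable_imp_abs_convergent[OF assms(2) z]
      square_summable_imp_abs_convergent[OF assms(4) z]]
  show "(\<lambda>n. dirichlet_conv a b (Suc n) * of_nat (Suc n) powr (- z)) sums (f z * g z)"
    by (simp only: dirichlet_conv_powr)
qed (use assms in \<open>simp add: has_dirichlet_series_def\<close>)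

section \<open>Kernel functions and their squares\<close>

lemma has_dirichlet_series_kernel_fun:
  assumes u: "u \<in> half_plane \<rho>"
  shows "has_dirichlet_series \<rho> (kernel_fun \<rho> c u)
    (\<lambda>n. of_real (c n) * of_nat n powr (- cnj u))"
  unfolding has_dirichlet_series_def
proof (intro conjI ballI allI impI)
  fix z assume z: "z \<in> half_plane \<rho>"
  have "summable (\<lambda>n. complex_of_real (c (Suc n)) * of_nat (Suc n) powr (- z - cnj u))"
    using kernel z u by (simp add: diagonal_dirichlet_kernel_def)
  then have "(\<lambda>n. complex_of_real (c (Suc n)) * of_nat (Suc n) powr (- z - cnj u)) sums
      kernel_fun \<rho> c u z"
    using z u by (simp add: kernel_fun_def dirichlet_kernel_def summable_sums)
  also have "(\<lambda>n. complex_of_real (c (Suc n)) * of_nat (Suc n) powr (- z - cnj u)) =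
      (\<lambda>n. of_real (c (Suc n)) * of_nat (Suc n) powr (- cnj u) * of_nat (Suc n) powr (- z))"
    by (simp only: diff_conv_add_uminus powr_add mult_ac)
  finally show "(\<lambda>n. of_real (c (Suc n)) * of_nat (Suc n) powr (- cnj u) *
      of_nat (Suc n) powr (- z)) sums kernel_fun \<rho> c u z" .
qed (simp add: kernel_fun_def dirichlet_kernel_def)

lemma square_summable_kernel_coeffs:
  assumes u: "u \<in> half_plane \<rho>"
  shows "square_summable_coeffs c (\<lambda>n. of_real (c n) * of_nat n powr (- cnj u))"
proof -
  have "(cmod (of_real (c (Suc n)) * of_nat (Suc n) powr (- cnj u)))\<^sup>2 / c (Suc n) =
      c (Suc n) * (real (Suc n) powr (- Re u))\<^sup>2" for n
    unfolding norm_mult norm_of_nat_powr norm_of_real using kernel_coeff_pos[of n]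
    by (simp add: power_mult_distrib power2_eq_square del: of_nat_Suc)
  with summable_kernel_weights[of "Re u"] u show ?thesis
    by (simp add: square_summable_coeffs_def half_plane_def del: of_nat_Suc)
qed

lemma kernel_fun_mem: "u \<in> half_plane \<rho> \<Longrightarrow> kernel_fun \<rho> c u \<in> dirichlet_rkhs \<rho> c"
  using has_dirichlet_series_kernel_fun square_summable_kernel_coeffs mem_dirichlet_rkhs by blast

lemma has_dirichlet_series_kernel_fun_square:
  assumes "u \<in> half_plane \<rho>"
  shows "has_dirichlet_series \<rho> (\<lambda>z. (kernel_fun \<rho> c u z)\<^sup>2)
    (\<lambda>n. of_real (dirichlet_conv c c n) * of_nat n powr (- cnj u))"
proof -
  have "dirichlet_conv (\<lambda>n. complex_of_real (c n) * of_nat n powr (- cnj u))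
      (\<lambda>n. complex_of_real (c n) * of_nat n powr (- cnj u)) =
      (\<lambda>n. of_real (dirichlet_conv c c n) * of_nat n powr (- cnj u))"
    unfolding dirichlet_conv_powr by (simp add: dirichlet_conv_def)
  with has_dirichlet_series_mult[OF has_dirichlet_series_kernel_fun[OF assms]
      square_summable_kernel_coeffs[OF assms] has_dirichlet_series_kernel_fun[OF assms]
      square_summable_kernel_coeffs[OF assms]]
  show ?thesis by (simp add: power2_eq_square)
qed

text \<open>The coefficients of the square at \<open>u\<close> have modulus
  \<open>\<bar>dirichlet_conv c c n\<bar> * n powr (- Re u)\<close>, which does not increase as
  \<open>Re u\<close> grows; comparison with \<open>t\<close> gives square summability.\<close>

lemma kernel_fun_square_mem_mono:
  assumes "t \<in> half_plane \<rho>" "Re t \<le> Re u"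
    and mem: "(\<lambda>z. (kernel_fun \<rho> c t z)\<^sup>2) \<in> dirichlet_rkhs \<rho> c"
  shows "(\<lambda>z. (kernel_fun \<rho> c u z)\<^sup>2) \<in> dirichlet_rkhs \<rho> c"
proof -
  have u: "u \<in> half_plane \<rho>" using assms by (simp add: half_plane_def)
  have t: "summable (\<lambda>n. (cmod (of_real (dirichlet_conv c c (Suc n)) *
      of_nat (Suc n) powr (- cnj t)))\<^sup>2 / c (Suc n))"
    using has_dirichlet_series_imp_square_summable[OF mem
        has_dirichlet_series_kernel_fun_square[OF assms(1)]]
    by (simp add: square_summable_coeffs_def)
  have "square_summable_coeffs c (\<lambda>n. of_real (dirichlet_conv c c n) * of_nat n powr (- cnj u))"
    unfolding square_summable_coeffs_def
  proof (rule summable_comparison_test'[OF t])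
    fix n
    have "real (Suc n) powr (- Re u) \<le> real (Suc n) powr (- Re t)"
      using assms(2) by (intro powr_mono) auto
    then have "cmod (of_real (dirichlet_conv c c (Suc n)) * of_nat (Suc n) powr (- cnj u)) \<le>
        cmod (of_real (dirichlet_conv c c (Suc n)) * of_nat (Suc n) powr (- cnj t))"
      unfolding norm_mult norm_of_nat_powr
      by (intro mult_left_mono) (simp_all del: of_nat_Suc)
    then show "norm ((cmod (of_real (dirichlet_conv c c (Suc n)) *
        of_nat (Suc n) powr (- cnj u)))\<^sup>2 / c (Suc n)) \<le>
        (cmod (of_real (dirichlet_conv c c (Suc n)) * of_nat (Suc n) powr (- cnj t)))\<^sup>2 / c (Suc n)"
      using kernel_coeff_pos[of n]
      by (simp only: real_norm_def abs_divide abs_power2 abs_of_pos)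
        (intro divide_right_mono power_mono, simp_all del: of_nat_Suc)
  qed
  with has_dirichlet_series_kernel_fun_square[OF u] show ?thesis
    using mem_dirichlet_rkhs by blast
qed

section \<open>Expansion of a bounded functional along the monomials\<close>

text \<open>The partial sums \<open>g N\<close> converge to \<open>f\<close> in norm: the squared
  norm of the remainder \<open>r N\<close> is a tail of the convergent norm series. Boundedness
  carries this over to the values of \<open>\<Lambda>\<close>.\<close>

lemma functional_sums:
  assumes \<Lambda>: "bounded_linear_functional \<rho> c \<Lambda>"
    and f: "has_dirichlet_series \<rho> f a" and a: "square_summable_coeffs c a"
  shows "(\<lambda>n. a (Suc n) * \<Lambda> (dirichlet_monomial \<rho> (Suc n))) sums \<Lambda> f"
proof -
  let ?e = "\<lambda>n. dirichlet_monomial \<rho> (Suc n)"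
  let ?w = "\<lambda>n. (cmod (a (Suc n)))\<^sup>2 / c (Suc n)"
  define g where "g = (\<lambda>N z. \<Sum>n<N. a (Suc n) * ?e n z)"
  define r where "r = (\<lambda>N z. f z - g N z)"
  have add: "\<Lambda> (\<lambda>z. p z + q z) = \<Lambda> p + \<Lambda> q"
    if "p \<in> dirichlet_rkhs \<rho> c" "q \<in> dirichlet_rkhs \<rho> c" for p q
    using \<Lambda> that by (simp add: bounded_linear_functional_def)
  have scale: "\<Lambda> (\<lambda>z. b * p z) = b * \<Lambda> p" if "p \<in> dirichlet_rkhs \<rho> c" for p b
    using \<Lambda> that by (simp add: bounded_linear_functional_def)
  obtain M where M: "\<And>p. p \<in> dirichlet_rkhs \<rho> c \<Longrightarrow> cmod (\<Lambda> p) \<le> M * dirichlet_norm \<rho> c p"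
    using \<Lambda> unfolding bounded_linear_functional_def by blast
  \<comment> \<open>\<open>g N\<close> adds the terms of index \<open>Suc n\<close> for
    \<open>n < N\<close>, so its coefficients are cut off after index \<open>N\<close>
    inclusive.\<close>
  have gs: "has_dirichlet_series \<rho> (g N) (\<lambda>n. if n \<le> N then a n else 0)" for N
    unfolding has_dirichlet_series_def
  proof (intro conjI ballI allI impI)
    fix z assume z: "z \<in> half_plane \<rho>"
    have "(\<lambda>n. if n \<in> {..<N} then a (Suc n) * of_nat (Suc n) powr (- z) else 0) sums
        (\<Sum>n<N. a (Suc n) * of_nat (Suc n) powr (- z))"
      by (rule sums_If_finite_set) simp
    also have "(\<lambda>n. if n \<in> {..<N} then a (Suc n) * of_nat (Suc n) powr (- z) else 0) =
        (\<lambda>n. (if Suc n \<le> N then a (Suc n) else 0) * of_nat (Suc n) powr (- z))"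
      by (auto simp: Suc_le_eq)
    also have "(\<Sum>n<N. a (Suc n) * of_nat (Suc n) powr (- z)) = g N z"
      using z by (simp add: g_def dirichlet_monomial_def)
    finally show "(\<lambda>n. (if Suc n \<le> N then a (Suc n) else 0) * of_nat (Suc n) powr (- z)) sums g N z" .
  qed (simp add: g_def dirichlet_monomial_def)
  have g_mem: "g N \<in> dirichlet_rkhs \<rho> c" for N
  proof -
    have "finite {n. (if Suc n \<le> N then a (Suc n) else 0) \<noteq> 0}"
      by (rule finite_subset[of _ "{..<N}"]) (auto split: if_splits)
    then have "square_summable_coeffs c (\<lambda>n. if n \<le> N then a n else 0)"
      by (rule square_summable_coeffs_finite)
    with gs show ?thesis using mem_dirichlet_rkhs by blast
  qed
  have rs: "has_dirichlet_series \<rho> (r N) (\<lambda>n. if n \<le> N then 0 else a n)" for N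
    unfolding has_dirichlet_series_def
  proof (intro conjI ballI allI impI)
    fix z assume z: "z \<in> half_plane \<rho>"
    have "(\<lambda>n. a (Suc n) * of_nat (Suc n) powr (- z) -
        (if Suc n \<le> N then a (Suc n) else 0) * of_nat (Suc n) powr (- z)) sums (f z - g N z)"
      using f gs[of N] z by (intro sums_diff) (auto simp: has_dirichlet_series_def)
    also have "(\<lambda>n. a (Suc n) * of_nat (Suc n) powr (- z) -
        (if Suc n \<le> N then a (Suc n) else 0) * of_nat (Suc n) powr (- z)) =
        (\<lambda>n. (if Suc n \<le> N then 0 else a (Suc n)) * of_nat (Suc n) powr (- z))"
      by auto
    finally show "(\<lambda>n. (if Suc n \<le> N then 0 else a (Suc n)) * of_nat (Suc n) powr (- z)) sums r N z"
      by (simp add: r_def)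
  qed (use f gs[of N] in \<open>simp add: r_def has_dirichlet_series_def\<close>)
  have tail: "(\<lambda>n. (cmod (if Suc n \<le> N then 0 else a (Suc n)))\<^sup>2 / c (Suc n)) sums
      (suminf ?w - sum ?w {..<N})" for N
  proof -
    have "(\<lambda>n. ?w n - (if n \<in> {..<N} then ?w n else 0)) sums (suminf ?w - sum ?w {..<N})"
      using a unfolding square_summable_coeffs_def
      by (intro sums_diff summable_sums sums_If_finite_set) auto
    also have "(\<lambda>n. ?w n - (if n \<in> {..<N} then ?w n else 0)) =
        (\<lambda>n. (cmod (if Suc n \<le> N then 0 else a (Suc n)))\<^sup>2 / c (Suc n))"
      by (auto simp: Suc_le_eq)
    finally show ?thesis .
  qed
  have r_mem: "r N \<in> dirichlet_rkhs \<rho> c" for N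
    using rs[of N] sums_summable[OF tail[of N]]
    unfolding mem_dirichlet_rkhs square_summable_coeffs_def by blast
  have r_norm: "dirichlet_norm \<rho> c (r N) = sqrt (suminf ?w - sum ?w {..<N})" for N
    unfolding dirichlet_norm_eq[OF rs] sums_unique[OF tail] by simp
  have g_val: "\<Lambda> (g N) = (\<Sum>n<N. a (Suc n) * \<Lambda> (?e n))" for N
  proof (induction N)
    case 0
    \<comment> \<open>The zero function is written as a multiple of a monomial so that homogeneity
      yields the value \<open>0\<close>.\<close>
    have "g 0 = (\<lambda>z. 0 * ?e 0 z)" by (simp add: g_def)
    then show ?case using scale[OF dirichlet_monomial_mem[of \<rho> 0], of 0] by simp
  next
    case (Suc N)
    have s: "(\<lambda>z. a (Suc N) * ?e N z) \<in> dirichlet_rkhs \<rho> c"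
    proof -
      have "has_dirichlet_series \<rho> (\<lambda>z. a (Suc N) * ?e N z)
          (\<lambda>n. a (Suc N) * (if n = Suc N then 1 else 0))"
        using has_dirichlet_series_monomial[of \<rho> N] sums_mult[of _ _ "a (Suc N)"]
        unfolding has_dirichlet_series_def mult.assoc by simp
      moreover have "square_summable_coeffs c (\<lambda>n. a (Suc N) * (if n = Suc N then 1 else 0))"
        by (rule square_summable_coeffs_finite) simp
      ultimately show ?thesis using mem_dirichlet_rkhs by blast
    qed
    have "g (Suc N) = (\<lambda>z. g N z + a (Suc N) * ?e N z)" by (simp add: g_def)
    then show ?case
      using add[OF g_mem[of N] s] scale[OF dirichlet_monomial_mem[of \<rho> N]] Suc by simp
  qed
  have "(\<lambda>N. M * sqrt (suminf ?w - sum ?w {..<N})) \<longlonglongrightarrow> M * sqrt (suminf ?w - suminf ?w)"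
    using a unfolding square_summable_coeffs_def
    by (intro tendsto_intros summable_LIMSEQ)
  moreover have "cmod (\<Lambda> (r N)) \<le> M * sqrt (suminf ?w - sum ?w {..<N})" for N
    using M[OF r_mem[of N]] r_norm[of N] by simp
  ultimately have "(\<lambda>N. \<Lambda> (r N)) \<longlonglongrightarrow> 0"
    by (intro Lim_null_comparison[of "\<lambda>N. \<Lambda> (r N)"] always_eventually allI) auto
  then have "(\<lambda>N. \<Lambda> f - \<Lambda> (r N)) \<longlonglongrightarrow> \<Lambda> f - 0"
    by (intro tendsto_intros)
  moreover have "\<Lambda> f - \<Lambda> (r N) = (\<Sum>n<N. a (Suc n) * \<Lambda> (?e n))" for N
    using add[OF g_mem[of N] r_mem[of N]] g_val[of N] by (simp add: r_def)
  ultimately show ?thesis by (simp add: sums_def)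
qed

text \<open>
  Rotating each coefficient so that every term of the expansion becomes nonnegative does not
  change the norm, so the expansion converges absolutely.
\<close>

lemma functional_abs_summable:
  assumes \<Lambda>: "bounded_linear_functional \<rho> c \<Lambda>" and a: "square_summable_coeffs c a"
  shows "summable (\<lambda>n. cmod (a (Suc n) * \<Lambda> (dirichlet_monomial \<rho> (Suc n))))"
proof -
  let ?L = "\<lambda>n. \<Lambda> (dirichlet_monomial \<rho> n)"
  define b where "b n = of_real (cmod (a n)) * cnj (sgn (?L n))" for n
  have "cmod (b n) \<le> cmod (a n)" for n
    by (simp add: b_def norm_mult norm_sgn)
  then have "square_summable_coeffs c b"
    using a kernel_coeff_pos unfolding square_summable_coeffs_def
    by (elim summable_comparison_test') (simp add: divide_right_mono power_mono less_imp_le)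
  from functional_sums[OF \<Lambda> has_dirichlet_series_dirichlet_fun[OF this] this]
  have "summable (\<lambda>n. b (Suc n) * ?L (Suc n))" by (rule sums_summable)
  also have "(\<lambda>n. b (Suc n) * ?L (Suc n)) =
      (\<lambda>n. complex_of_real (cmod (a (Suc n) * ?L (Suc n))))"
  proof
    fix n
    have "cnj (sgn w) * w = of_real (cmod w)" for w :: complex
      by (cases "w = 0")
        (simp_all add: sgn_eq complex_norm_square[symmetric] mult.commute power2_eq_square)
    then show "b (Suc n) * ?L (Suc n) = complex_of_real (cmod (a (Suc n) * ?L (Suc n)))"
      by (simp add: b_def norm_mult mult.assoc)
  qed
  finally show ?thesis using summable_of_real_iff by blast
qed

end

section \<open>From the convolution identity to complete multiplicativity\<close>

text \<open>
  For \<open>n = d e\<close> with proper factors, \<open>L d * L e\<close> does not depend on the factorization by the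
  induction hypothesis (refine two factorizations to a common one). The identity then reads
  \<open>S * (L n - L d * L e) = 0\<close>, where \<open>S > 0\<close> is the sum of \<open>c d * c (n div d)\<close> over proper
  divisors.
\<close>

lemma completely_multiplicativeI:
  fixes L :: "nat \<Rightarrow> complex" and c :: "nat \<Rightarrow> real"
  assumes pos: "\<And>n. n \<ge> 1 \<Longrightarrow> c n > 0" and one: "L 1 = 1"
    and conv: "\<And>n. n \<ge> 1 \<Longrightarrow> of_real (dirichlet_conv c c n) * L n =
      dirichlet_conv (\<lambda>n. of_real (c n) * L n) (\<lambda>n. of_real (c n) * L n) n"
  shows "m \<ge> 1 \<Longrightarrow> n \<ge> 1 \<Longrightarrow> L (m * n) = L m * L n"
proof (induction "m * n" arbitrary: m n rule: less_induct)
  case less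
  show ?case
  proof (cases "m = 1 \<or> n = 1")
    case True
    then show ?thesis using one by auto
  next
    case False
    define k where "k = m * n"
    have mn: "m > 1" "n > 1" using less.prems False by auto
    then have k: "k \<ge> 1" "m \<noteq> k" "m dvd k" by (auto simp: k_def)
    define D where "D = {d. d dvd k} - {1, k}"
    have finD: "finite D" using k by (simp add: D_def)
    have IH: "L (p * q) = L p * L q" if "p * q < k" "p \<ge> 1" "q \<ge> 1" for p q
      using less.hyps[of p q] that by (simp add: k_def)
    have indep: "L d * L (k div d) = L m * L n" if "d \<in> D" for d
    proof -
      obtain e where e: "k = d * e" using \<open>d \<in> D\<close> by (auto simp: D_def)
      have "d \<ge> 1" "e \<ge> 1" using k(1) e by (auto simp: Suc_le_eq intro!: Nat.gr0I)
      with \<open>d \<in> D\<close> e have de: "d > 1" "e > 1" by (auto simp: D_def)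
      \<comment> \<open>The common refinement: with \<open>m = x * v\<close> and
        \<open>n = y * w\<close>, one gets \<open>d = x * y\<close> and \<open>e = v * w\<close>, so
        both products of values become \<open>L x * L y * L v * L w\<close>.\<close>
      obtain x y where xy: "d = x * y" "x dvd m" "y dvd n"
        using division_decomp[of d m n] e by (metis dvd_triv_left k_def)
      obtain v where v: "m = x * v" using xy by auto
      obtain w where w: "n = y * w" using xy by auto
      have "x * y * (v * w) = x * y * e" using e xy(1) v w by (simp add: k_def mult_ac)
      then have ew: "e = v * w" using xy(1) de by auto
      have ge: "x \<ge> 1" "y \<ge> 1" "v \<ge> 1" "w \<ge> 1"
        using de(1) xy(1) mn v w by (auto simp: Suc_le_eq intro!: Nat.gr0I)
      have "d < k" "e < k" using de by (simp_all add: e)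
      moreover have "m < k" "n < k" using mn by (simp_all add: k_def)
      ultimately have "L d = L x * L y" "L e = L v * L w" "L m = L x * L v" "L n = L y * L w"
        using IH ge xy(1) ew v w by auto
      moreover have "k div d = e" using e de by simp
      ultimately show ?thesis by (simp add: mult_ac)
    qed
    have divs: "{d. d dvd k} = insert 1 (insert k D)" by (auto simp: D_def)
    \<comment> \<open>Stated for a general ring because it is applied to the real convolution of
      \<open>c\<close> and to the complex one of \<open>c\<close> times \<open>L\<close>.\<close>
    have split: "dirichlet_conv f g k = f 1 * g k + (f k * g 1 + (\<Sum>d\<in>D. f d * g (k div d)))"
      for f g :: "nat \<Rightarrow> 'b::comm_ring_1"
      using k mn finD unfolding dirichlet_conv_def divs
      by (subst sum.insert; (subst sum.insert)?) (auto simp: D_def k_def)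
    have "(\<Sum>d\<in>D. of_real (c d) * L d * (of_real (c (k div d)) * L (k div d))) =
        (\<Sum>d\<in>D. of_real (c d * c (k div d)) * (L m * L n))"
      by (intro sum.cong refl) (simp add: indep[symmetric] mult_ac)
    also have "\<dots> = of_real (\<Sum>d\<in>D. c d * c (k div d)) * (L m * L n)"
      by (simp add: sum_distrib_right)
    \<comment> \<open>As \<open>L 1 = 1\<close>, the divisors \<open>1\<close> and \<open>k\<close>
      contribute the same terms \<open>c 1 * c k * L k\<close> on both sides of \<open>conv\<close>,
      and these cancel.\<close>
    finally have "of_real (\<Sum>d\<in>D. c d * c (k div d)) * L k =
        of_real (\<Sum>d\<in>D. c d * c (k div d)) * (L m * L n)"
      using conv[OF k(1)] one unfolding split by (simp add: algebra_simps)
    moreover have "(\<Sum>d\<in>D. c d * c (k div d)) > 0"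
    proof (rule sum_pos[OF finD])
      show "D \<noteq> {}" using mn k by (auto simp: D_def)
      fix d assume "d \<in> D"
      then have "d dvd k" by (simp add: D_def)
      then have "d \<ge> 1" "k div d \<ge> 1" using k(1)
        by (auto simp: Suc_le_eq dvd_div_eq_0_iff intro!: Nat.gr0I)
      then show "c d * c (k div d) > 0" using pos by simp
    qed
    ultimately show ?thesis unfolding k_def mult_cancel_left of_real_eq_0_iff by linarith
  qed
qed

section \<open>Membership of the squares and the test for multiplicativity\<close>

theorem theorem3:
  fixes \<rho> t :: real and c :: "nat \<Rightarrow> real"
  assumes "diagonal_dirichlet_kernel \<rho> c"
    and "t > \<rho>"
    and "(\<lambda>z. (kernel_fun \<rho> c (of_real t) z)\<^sup>2) \<in> dirichlet_rkhs \<rho> c"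
  shows "(\<forall>u\<in>half_plane t. (\<lambda>z. (kernel_fun \<rho> c u z)\<^sup>2) \<in> dirichlet_rkhs \<rho> c) \<and>
    (\<forall>\<Lambda>. bounded_linear_functional \<rho> c \<Lambda> \<and> \<Lambda> (one_fun \<rho>) = 1 \<longrightarrow>
       (multiplicative_functional \<rho> c \<Lambda> \<longleftrightarrow>
          (\<forall>u\<in>half_plane t. \<Lambda> (\<lambda>z. (kernel_fun \<rho> c u z)\<^sup>2) = (\<Lambda> (kernel_fun \<rho> c u))\<^sup>2)))"
proof (intro conjI allI impI)
  note K = assms(1)
  have sub: "u \<in> half_plane \<rho>" if "u \<in> half_plane t" for u
    using that assms(2) by (simp add: half_plane_def)
  have mem: "(\<lambda>z. (kernel_fun \<rho> c u z)\<^sup>2) \<in> dirichlet_rkhs \<rho> c" if "u \<in> half_plane t" for u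
    by (rule kernel_fun_square_mem_mono[OF K _ _ assms(3)])
      (use that assms(2) in \<open>auto simp: half_plane_def\<close>)
  then show "\<forall>u\<in>half_plane t. (\<lambda>z. (kernel_fun \<rho> c u z)\<^sup>2) \<in> dirichlet_rkhs \<rho> c" by blast
  fix \<Lambda> assume "bounded_linear_functional \<rho> c \<Lambda> \<and> \<Lambda> (one_fun \<rho>) = 1"
  then have \<Lambda>: "bounded_linear_functional \<rho> c \<Lambda>" and \<Lambda>1: "\<Lambda> (one_fun \<rho>) = 1" by auto
  define L where "L n = \<Lambda> (dirichlet_monomial \<rho> n)" for n
  have expansion: "(\<lambda>n. a (Suc n) * L (Suc n)) sums \<Lambda> f"
    if "has_dirichlet_series \<rho> f a" "square_summable_coeffs c a" for f a
    using functional_sums[OF K \<Lambda> that] by (simp add: L_def)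
  have product: "(\<lambda>n. dirichlet_conv (\<lambda>n. a n * L n) (\<lambda>n. b n * L n) (Suc n)) sums (\<Lambda> f * \<Lambda> g)"
    if "has_dirichlet_series \<rho> f a" "square_summable_coeffs c a"
      "has_dirichlet_series \<rho> g b" "square_summable_coeffs c b" for f g a b
    using dirichlet_conv_sums[of "\<lambda>n. a n * L n" "\<lambda>n. b n * L n"]
      functional_abs_summable[OF K \<Lambda> that(2)] functional_abs_summable[OF K \<Lambda> that(4)]
      expansion[OF that(1,2)] expansion[OF that(3,4)]
    by (simp add: L_def sums_iff)
  show "multiplicative_functional \<rho> c \<Lambda> \<longleftrightarrow>
      (\<forall>u\<in>half_plane t. \<Lambda> (\<lambda>z. (kernel_fun \<rho> c u z)\<^sup>2) = (\<Lambda> (kernel_fun \<rho> c u))\<^sup>2)"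
  proof
    assume "multiplicative_functional \<rho> c \<Lambda>"
    then show "\<forall>u\<in>half_plane t. \<Lambda> (\<lambda>z. (kernel_fun \<rho> c u z)\<^sup>2) = (\<Lambda> (kernel_fun \<rho> c u))\<^sup>2"
      using mem kernel_fun_mem[OF K sub]
      by (simp add: multiplicative_functional_def power2_eq_square)
  next
    assume sq: "\<forall>u\<in>half_plane t. \<Lambda> (\<lambda>z. (kernel_fun \<rho> c u z)\<^sup>2) = (\<Lambda> (kernel_fun \<rho> c u))\<^sup>2"
    define cL where "cL n = of_real (c n) * L n" for n
    define d where "d n = of_real (dirichlet_conv c c n) * L n - dirichlet_conv cL cL n" for n
    have "(\<lambda>n. d (Suc n) * of_nat (Suc n) powr (- z)) sums 0" if "z \<in> half_plane t" for z
    proof -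
      \<comment> \<open>The kernel coefficients involve the conjugate of \<open>u\<close>, and
        conjugation preserves \<open>half_plane t\<close>; this choice turns both sides into
        Dirichlet series in \<open>z\<close>.\<close>
      define u where "u = cnj z"
      have u: "u \<in> half_plane t" using that by (simp add: half_plane_def u_def)
      note ser = has_dirichlet_series_kernel_fun[OF K sub[OF u]]
        square_summable_kernel_coeffs[OF K sub[OF u]]
      note ser2 = has_dirichlet_series_kernel_fun_square[OF K sub[OF u]]
      have "(\<lambda>n. of_real (dirichlet_conv c c (Suc n)) * of_nat (Suc n) powr (- z) * L (Suc n))
          sums \<Lambda> (\<lambda>z. (kernel_fun \<rho> c u z)\<^sup>2)"
        \<comment> \<open>Expanding \<open>\<Lambda>\<close> on the square requires the square to
          lie in the space, which is the first assertion.\<close>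
        using expansion[OF ser2 has_dirichlet_series_imp_square_summable[OF mem[OF u] ser2]]
        by (simp add: u_def)
      moreover have "(\<lambda>n. dirichlet_conv cL cL (Suc n) * of_nat (Suc n) powr (- z)) sums
          (\<Lambda> (kernel_fun \<rho> c u))\<^sup>2"
      proof -
        have "(\<lambda>n. complex_of_real (c n) * of_nat n powr (- cnj u) * L n) =
            (\<lambda>n. cL n * of_nat n powr (- z))"
          by (simp add: cL_def u_def mult_ac)
        with product[OF ser ser] show ?thesis
          by (simp only: dirichlet_conv_powr power2_eq_square)
      qed
      ultimately have "(\<lambda>n. of_real (dirichlet_conv c c (Suc n)) * of_nat (Suc n) powr (- z) *
          L (Suc n) - dirichlet_conv cL cL (Suc n) * of_nat (Suc n) powr (- z)) sums
          (\<Lambda> (\<lambda>z. (kernel_fun \<rho> c u z)\<^sup>2) - (\<Lambda> (kernel_fun \<rho> c u))\<^sup>2)"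
        by (rule sums_diff)
      then show ?thesis using sq u by (simp add: d_def algebra_simps)
    qed
    \<comment> \<open>Uniqueness of coefficients is applied on the smaller half plane
      \<open>half_plane t\<close>, where the vanishing has been established.\<close>
    then have d0: "d (Suc n) = 0" for n by (rule dirichlet_series_zero)
    have L_mult: "L (m * n) = L m * L n" if "m \<ge> 1" "n \<ge> 1" for m n
    proof (rule completely_multiplicativeI[of c L, OF _ _ _ that])
      show "c n > 0" if "n \<ge> 1" for n
        using K that by (simp add: diagonal_dirichlet_kernel_def)
      show "L 1 = 1" using \<Lambda>1 by (simp add: L_def one_fun_eq_dirichlet_monomial)
      show "of_real (dirichlet_conv c c n) * L n =
          dirichlet_conv (\<lambda>n. of_real (c n) * L n) (\<lambda>n. of_real (c n) * L n) n" if "n \<ge> 1" for n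
        using d0[of "n - 1"] that by (simp add: d_def cL_def[abs_def])
    qed
    show "multiplicative_functional \<rho> c \<Lambda>"
      unfolding multiplicative_functional_def
    proof (intro ballI impI)
      fix f g assume "f \<in> dirichlet_rkhs \<rho> c" "g \<in> dirichlet_rkhs \<rho> c"
        and fg: "(\<lambda>z. f z * g z) \<in> dirichlet_rkhs \<rho> c"
      then obtain a b where a: "has_dirichlet_series \<rho> f a" "square_summable_coeffs c a"
        and b: "has_dirichlet_series \<rho> g b" "square_summable_coeffs c b"
        unfolding mem_dirichlet_rkhs by blast
      note ab = has_dirichlet_series_mult[OF K a b]
      have "(\<lambda>n. dirichlet_conv a b (Suc n) * L (Suc n)) sums \<Lambda> (\<lambda>z. f z * g z)"
        \<comment> \<open>The assumed membership of the product makes its convolution coefficients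
          square summable.\<close>
        by (rule expansion[OF ab has_dirichlet_series_imp_square_summable[OF fg ab]])
      also have "(\<lambda>n. dirichlet_conv a b (Suc n) * L (Suc n)) =
          (\<lambda>n. dirichlet_conv (\<lambda>n. a n * L n) (\<lambda>n. b n * L n) (Suc n))"
      proof
        fix n
        \<comment> \<open>Complete multiplicativity lets \<open>L (Suc n)\<close> be distributed
          over the two factors of every term of the divisor sum.\<close>
        have "L (Suc n) = L d * L (Suc n div d)" if "d dvd Suc n" for d
        proof -
          obtain e where e: "Suc n = d * e" using \<open>d dvd Suc n\<close> by (rule dvdE)
          then have "d \<ge> 1" "e \<ge> 1" by (auto simp: Suc_le_eq intro!: Nat.gr0I)
          moreover from this have "Suc n div d = e" unfolding e by simp
          ultimately show ?thesis using L_mult e by simp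
        qed
        then show "dirichlet_conv a b (Suc n) * L (Suc n) =
            dirichlet_conv (\<lambda>n. a n * L n) (\<lambda>n. b n * L n) (Suc n)"
          unfolding dirichlet_conv_def sum_distrib_right by (intro sum.cong refl) (simp add: mult_ac)
      qed
      finally show "\<Lambda> (\<lambda>z. f z * g z) = \<Lambda> f * \<Lambda> g"
        using product[OF a b] by (rule sums_unique2)
    qed
  qed
qed

end
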